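(* Let $N\ge2$, let $\mathbf k=(k_1,\dots,k_N)$ be positive integers, and let $F\subseteq\mathcal E_N$. The following conditions are equivalent: (i) $\mu_{\mathbf k}(F)>0$; (ii) the residual margins $r_i(F)$ and $s_j(F)$ are nonnegative for all $i,j\in[N]$, and $$\sum_{i\in I}r_i(F)\le\sum_{j\in N_F^-(I)}s_j(F)\qquad\text{for every }I\subseteq[N].$$
   Context: Let $[N]=\{1,\dots,N\}$ and $\mathcal E_N=\{(j,i):1\le i,j\le N,\ j\ne i\}$, with $(j,i)$ written $j\to i$. A balanced $\mathbf k$-factor is $a\in\mathbb Z_{\ge0}^{\mathcal E_N}$ with $\sum_{j\ne i}a_{ji}=k_i$ for all $i$ and $\sum_{i\ne j}a_{ji}=k_j$ for all $j$; $\mathfrak E_{\mathbf k}(\mathcal E_N)$ is the set of these, $\operatorname{supp}(a)=\{(j,i):a_{ji}>0\}$, and $w_{\mathbf k}(a)=\prod_{i=1}^N\frac{k_i!}{\prod_{j\ne i}a_{ji}!}$. The exact-support coefficient is $\mu_{\mathbf k}(F)=\sum_{a\in\mathfrak E_{\mathbf k}(\mathcal E_N),\ \operatorname{supp}(a)=F}w_{\mathbf k}(a)$. Put $d_i^L(F)=|\{j:j\to i\in F\}|$, $d_j^R(F)=|\{i:j\to i\in F\}|$, $r_i(F)=k_i-d_i^L(F)$, $s_j(F)=k_j-d_j^R(F)$, and $N_F^-(I)=\{j:j\to i\in F\text{ for some }i\in I\}$. *)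

theory Defs
  imports Complex_Main "HOL-Library.FuncSet"
begin

text \<open>An edge \<open>j \<rightarrow> i\<close> is the pair \<open>(j, i)\<close>: source first, target second.\<close>

definition edges :: "nat \<Rightarrow> (nat \<times> nat) set" where
  "edges N = {(j, i). j \<in> {1..N} \<and> i \<in> {1..N} \<and> j \<noteq> i}"

text \<open>Members of \<open>\<int>\<^sub>\<ge>\<^sub>0\<^bsup>edges N\<^esup>\<close> are extensional functions (\<open>undefined\<close> off \<open>edges N\<close>), so that each
  multiplicity array is represented exactly once.\<close>

definition balanced_factors :: "nat \<Rightarrow> (nat \<Rightarrow> nat) \<Rightarrow> (nat \<times> nat \<Rightarrow> nat) set" where
  "balanced_factors N k = {a \<in> edges N \<rightarrow>\<^sub>E UNIV.
     (\<forall>i\<in>{1..N}. (\<Sum>j\<in>{1..N} - {i}. a (j, i)) = k i) \<and>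
     (\<forall>j\<in>{1..N}. (\<Sum>i\<in>{1..N} - {j}. a (j, i)) = k j)}"

definition supp :: "nat \<Rightarrow> (nat \<times> nat \<Rightarrow> nat) \<Rightarrow> (nat \<times> nat) set" where
  "supp N a = {e \<in> edges N. a e > 0}"

definition weight :: "nat \<Rightarrow> (nat \<Rightarrow> nat) \<Rightarrow> (nat \<times> nat \<Rightarrow> nat) \<Rightarrow> real" where
  "weight N k a = (\<Prod>i\<in>{1..N}. fact (k i) / (\<Prod>j\<in>{1..N} - {i}. fact (a (j, i))))"

definition exact_support_coeff :: "nat \<Rightarrow> (nat \<Rightarrow> nat) \<Rightarrow> (nat \<times> nat) set \<Rightarrow> real" where
  "exact_support_coeff N k F = (\<Sum>a\<in>{a \<in> balanced_factors N k. supp N a = F}. weight N k a)"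

definition in_deg :: "(nat \<times> nat) set \<Rightarrow> nat \<Rightarrow> nat" where
  "in_deg F i = card {j. (j, i) \<in> F}"

definition out_deg :: "(nat \<times> nat) set \<Rightarrow> nat \<Rightarrow> nat" where
  "out_deg F j = card {i. (j, i) \<in> F}"

text \<open>The residual margins \<open>r\<^sub>i(F)\<close> and \<open>s\<^sub>j(F)\<close>; they are integers because they may be negative.\<close>

definition in_residual :: "(nat \<Rightarrow> nat) \<Rightarrow> (nat \<times> nat) set \<Rightarrow> nat \<Rightarrow> int" where
  "in_residual k F i = int (k i) - int (in_deg F i)"

definition out_residual :: "(nat \<Rightarrow> nat) \<Rightarrow> (nat \<times> nat) set \<Rightarrow> nat \<Rightarrow> int" where
  "out_residual k F j = int (k j) - int (out_deg F j)"

definition in_nbrs :: "(nat \<times> nat) set \<Rightarrow> nat set \<Rightarrow> nat set" where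
  "in_nbrs F I = {j. \<exists>i\<in>I. (j, i) \<in> F}"

text \<open>The sum defining \<^const>\<open>exact_support_coeff\<close> is over a finite set, so it is a genuine sum.\<close>

lemma finite_edges: "finite (edges N)"
  by (rule finite_subset[of _ "{1..N} \<times> {1..N}"]) (auto simp: edges_def)

lemma finite_balanced_factors: "finite (balanced_factors N k)"
proof (rule finite_subset)
  show "balanced_factors N k \<subseteq> (\<Pi>\<^sub>E e\<in>edges N. {..k (snd e)})"
  proof
    fix a assume a: "a \<in> balanced_factors N k"
    have "a (j, i) \<le> k i" if "(j, i) \<in> edges N" for j i
    proof -
      have "j \<in> {1..N} - {i}" "i \<in> {1..N}"
        using that by (auto simp: edges_def)
      moreover from this have "(\<Sum>j\<in>{1..N} - {i}. a (j, i)) = k i"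
        using a by (auto simp: balanced_factors_def)
      ultimately show ?thesis
        using member_le_sum[of j "{1..N} - {i}" "\<lambda>j. a (j, i)"] by simp
    qed
    with a show "a \<in> (\<Pi>\<^sub>E e\<in>edges N. {..k (snd e)})"
      by (auto simp: balanced_factors_def PiE_iff)
  qed
  show "finite (\<Pi>\<^sub>E e\<in>edges N. {..k (snd e)})"
    by (intro finite_PiE finite_edges) auto
qed

end

theory Submission
  imports Defs
begin

text \<open>
  An array with support exactly \<open>F\<close> is the indicator of \<open>F\<close> plus a nonnegative array supported
  in \<open>F\<close> whose margins are the residual margins. Hence the claim is the supply-demand form of Hall's
  theorem. It follows by induction on the total demand: some unit of demand at a given \<open>i\<close> can be
  served without violating Hall's condition, since otherwise every available neighbour of \<open>i\<close> is a
  neighbour of a tight set avoiding \<open>i\<close>; tight sets are closed under union, so all these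
  neighbours lie in the neighbourhood of one tight set \<open>T\<close>, and \<open>insert i T\<close> violates Hall's condition.
\<close>

section \<open>Tight sets and the supply-demand form of Hall's theorem\<close>

lemma tight_Un:
  fixes r :: "'a \<Rightarrow> nat" and s :: "'b \<Rightarrow> nat"
  assumes "finite A" "finite B" "R \<subseteq> A \<times> B"
    and hall: "\<And>I. I \<subseteq> A \<Longrightarrow> sum r I \<le> sum s (R `` I)"
    and "S \<subseteq> A" "T \<subseteq> A" "sum r S = sum s (R `` S)" "sum r T = sum s (R `` T)"
  shows "sum r (S \<union> T) = sum s (R `` (S \<union> T))"
proof -
  have fin: "finite (R `` X)" for X
    by (rule finite_subset[OF _ \<open>finite B\<close>]) (use assms(3) in auto)
  have "finite S" "finite T"
    using assms(1,5,6) by (auto intro: finite_subset)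
  then have "sum r (S \<union> T) + sum r (S \<inter> T) = sum s (R `` S) + sum s (R `` T)"
    using assms(7,8) by (simp add: sum.union_inter)
  also have "\<dots> = sum s (R `` (S \<union> T)) + sum s (R `` S \<inter> R `` T)"
    by (simp add: Image_Un sum.union_inter fin)
  finally have eq: "sum r (S \<union> T) + sum r (S \<inter> T)
    = sum s (R `` (S \<union> T)) + sum s (R `` S \<inter> R `` T)" .
  \<comment> \<open>Image commutes with unions, but for intersections only one inclusion holds; it
    goes the right way. Both Hall inequalities then bound the two sides of \<open>eq\<close>
    termwise, so each must be an equality.\<close>
  have "sum r (S \<inter> T) \<le> sum s (R `` (S \<inter> T))"
    using assms(5) by (intro hall) auto
  also have "\<dots> \<le> sum s (R `` S \<inter> R `` T)"
    by (rule sum_mono2) (auto simp: fin)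
  finally have "sum r (S \<inter> T) \<le> sum s (R `` S \<inter> R `` T)" .
  moreover have "sum r (S \<union> T) \<le> sum s (R `` (S \<union> T))"
    using assms(5,6) by (intro hall) auto
  ultimately show ?thesis using eq by linarith
qed

lemma tight_Union:
  fixes r :: "'a \<Rightarrow> nat" and s :: "'b \<Rightarrow> nat"
  assumes "finite A" "finite B" "R \<subseteq> A \<times> B"
    and "\<And>I. I \<subseteq> A \<Longrightarrow> sum r I \<le> sum s (R `` I)"
    and "finite \<C>" "\<And>T. T \<in> \<C> \<Longrightarrow> T \<subseteq> A \<and> sum r T = sum s (R `` T)"
  shows "sum r (\<Union>\<C>) = sum s (R `` \<Union>\<C>)"
  using assms(5,6)
proof (induction \<C>)
  case (insert T \<C>)
  then have "sum r (T \<union> \<Union>\<C>) = sum s (R `` (T \<union> \<Union>\<C>))"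
    by (intro tight_Un[OF assms(1-4)]) auto
  then show ?case by simp
qed simp

text \<open>Provides an edge along which one unit can be shipped. A set containing \<open>i\<close>
  loses a unit on both sides, and a set whose image misses \<open>j\<close> loses no supply; only
  the remaining sets need strict slack.\<close>

lemma hall_step:
  fixes r :: "'a \<Rightarrow> nat" and s :: "'b \<Rightarrow> nat"
  assumes fin: "finite A" "finite B" "R \<subseteq> A \<times> B"
    and hall: "\<And>I. I \<subseteq> A \<Longrightarrow> sum r I \<le> sum s (R `` I)"
    and i: "i \<in> A" "r i > 0"
  shows "\<exists>j. (i, j) \<in> R \<and> s j > 0 \<and>
    (\<forall>I\<subseteq>A. i \<notin> I \<longrightarrow> j \<in> R `` I \<longrightarrow> sum r I < sum s (R `` I))"
proof (rule ccontr)
  assume contra: "\<not> ?thesis"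
  \<comment> \<open>The largest tight set avoiding \<open>i\<close>: tight sets are closed under
    finite unions, and \<open>A\<close> has finitely many subsets.\<close>
  define T where "T = \<Union>{I. I \<subseteq> A - {i} \<and> sum r I = sum s (R `` I)}"
  have blocked: "j \<in> R `` T" if "(i, j) \<in> R" "s j > 0" for j
  proof -
    have "\<not> (\<forall>I\<subseteq>A. i \<notin> I \<longrightarrow> j \<in> R `` I \<longrightarrow> sum r I < sum s (R `` I))"
      using spec[OF contra[unfolded not_ex], of j] that by simp
    then obtain I where I: "I \<subseteq> A" "i \<notin> I" "j \<in> R `` I" "\<not> sum r I < sum s (R `` I)"
      by metis
    then have "sum r I = sum s (R `` I)" using hall[OF I(1)] by simp
    with I have "I \<subseteq> T" unfolding T_def by (intro Union_upper) auto
    with I(3) show ?thesis by blast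
  qed
  have tight: "sum r T = sum s (R `` T)"
    unfolding T_def using fin by (intro tight_Union[OF fin hall]) auto
  have T: "T \<subseteq> A - {i}" unfolding T_def by blast
  have "sum r (insert i T) \<le> sum s (R `` insert i T)"
    using T i by (intro hall) auto
  \<comment> \<open>Adding \<open>i\<close> contributes only neighbours with no supply left, since
    \<open>blocked\<close> puts the others in the image of \<open>T\<close>.\<close>
  also have "\<dots> = sum s (R `` T)"
  proof (rule sum.mono_neutral_right)
    show "finite (R `` insert i T)"
      by (rule finite_subset[OF _ \<open>finite B\<close>]) (use fin in auto)
    show "R `` T \<subseteq> R `` insert i T" by auto
    show "\<forall>j\<in>R `` insert i T - R `` T. s j = 0" using blocked by auto
  qed
  finally have "sum r (insert i T) \<le> sum r T" using tight by simp
  moreover have "finite T" "i \<notin> T" using T finite_subset[OF T] fin by auto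
  ultimately show False using i by simp
qed

lemma sum_fun_upd_pred:
  fixes f :: "'a \<Rightarrow> nat"
  assumes "finite S" "x \<in> S" "f x > 0"
  shows "Suc (sum (f(x := f x - 1)) S) = sum f S"
  using assms by (simp add: sum.remove[of S x])

text \<open>Supplies are only bounded above, as Hall's condition permits a surplus. Each induction
  step removes a unit from both \<open>r\<close> and \<open>s\<close>, so both are
  generalized.\<close>

lemma hall_supply_demand:
  fixes r :: "'a \<Rightarrow> nat" and s :: "'b \<Rightarrow> nat"
  assumes fin: "finite A" "finite B" "R \<subseteq> A \<times> B"
    and hall: "\<And>I. I \<subseteq> A \<Longrightarrow> sum r I \<le> sum s (R `` I)"
  shows "\<exists>b :: 'a \<Rightarrow> 'b \<Rightarrow> nat. (\<forall>i j. b i j > 0 \<longrightarrow> (i, j) \<in> R) \<and>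
    (\<forall>i\<in>A. (\<Sum>j\<in>B. b i j) = r i) \<and> (\<forall>j\<in>B. (\<Sum>i\<in>A. b i j) \<le> s j)"
  using hall
proof (induction "sum r A" arbitrary: r s)
  case 0
  then have "\<forall>i\<in>A. r i = 0" using fin by simp
  then show ?case by (intro exI[of _ "\<lambda>_ _. 0"]) auto
next
  case (Suc n)
  have "\<exists>i\<in>A. r i > 0"
    using Suc.hyps(2) by (metis bot_nat_0.not_eq_extremum nat.distinct(1) sum.neutral)
  then obtain i where i: "i \<in> A" "r i > 0" by blast
  obtain j where j: "(i, j) \<in> R" "s j > 0"
    and slack: "\<And>I. I \<subseteq> A \<Longrightarrow> i \<notin> I \<Longrightarrow> j \<in> R `` I \<Longrightarrow> sum r I < sum s (R `` I)"
    using hall_step[OF fin Suc.prems i] by blast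
  have "j \<in> B" using j fin by auto
  let ?r = "r(i := r i - 1)" and ?s = "s(j := s j - 1)"
  have finR: "finite (R `` X)" for X
    by (rule finite_subset[OF _ \<open>finite B\<close>]) (use fin in auto)
  have "n = sum ?r A"
    using sum_fun_upd_pred[of A i r] fin i Suc.hyps(2) by simp
  moreover have "sum ?r I \<le> sum ?s (R `` I)" if "I \<subseteq> A" for I
  proof -
    have "finite I" using that fin finite_subset by blast
    have r_out: "i \<notin> I \<Longrightarrow> sum ?r I = sum r I" and s_out: "j \<notin> R `` I \<Longrightarrow> sum ?s (R `` I) = sum s (R `` I)"
      by (auto intro!: sum.cong)
    note r_in = sum_fun_upd_pred[of I i r, OF \<open>finite I\<close> _ i(2)]
      and s_in = sum_fun_upd_pred[of "R `` I" j s, OF finR _ j(2)]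
    show ?thesis
    proof (cases "i \<in> I")
      case True
      then have "j \<in> R `` I" using j by auto
      from Suc.prems[OF that] r_in[OF True] s_in[OF this] show ?thesis by linarith
    next
      case False
      show ?thesis
      proof (cases "j \<in> R `` I")
        case True
        from slack[OF that False True] r_out[OF False] s_in[OF True] show ?thesis by linarith
      next
        case notin: False
        from Suc.prems[OF that] r_out[OF False] s_out[OF notin] show ?thesis by linarith
      qed
    qed
  qed
  ultimately obtain b :: "'a \<Rightarrow> 'b \<Rightarrow> nat" where b: "\<forall>i j. b i j > 0 \<longrightarrow> (i, j) \<in> R"
    "\<forall>i\<in>A. (\<Sum>j\<in>B. b i j) = ?r i" "\<forall>j\<in>B. (\<Sum>i\<in>A. b i j) \<le> ?s j"
    using Suc.hyps(1)[of ?r ?s] by blast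
  \<comment> \<open>The single unit shipped from \<open>j\<close> to \<open>i\<close>, to be added
    back to the array \<open>b\<close> for the reduced margins.\<close>
  let ?d = "\<lambda>x y. of_bool (x = i) * of_bool (y = j) :: nat"
  have rows: "(\<Sum>y\<in>B. ?d x y) = of_bool (x = i)" for x
    using \<open>j \<in> B\<close> fin by (simp flip: sum_distrib_left add: of_bool_def)
  have cols: "(\<Sum>x\<in>A. ?d x y) = of_bool (y = j)" for y
    using i fin by (simp flip: sum_distrib_right add: of_bool_def)
  show ?case
  proof (intro exI[of _ "\<lambda>x y. b x y + ?d x y"] conjI allI ballI impI)
    fix x y assume "0 < b x y + ?d x y"
    then show "(x, y) \<in> R" using b(1) j by (auto split: if_splits)
  next
    fix x assume "x \<in> A"
    then show "(\<Sum>y\<in>B. b x y + ?d x y) = r x"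
      using b(2) i by (simp add: sum.distrib rows)
  next
    fix y assume "y \<in> B"
    then have "(\<Sum>x\<in>A. b x y) \<le> ?s y" using b(3) by blast
    then show "(\<Sum>x\<in>A. b x y + ?d x y) \<le> s y"
      using j by (auto simp: sum.distrib cols split: if_splits)
  qed
qed

text \<open>When total demand equals total supply, the column bounds add up to an equality, which
  forces every one of them to be an equality.\<close>

lemma transport_exists:
  fixes r :: "'a \<Rightarrow> nat" and s :: "'b \<Rightarrow> nat"
  assumes fin: "finite A" "finite B" "R \<subseteq> A \<times> B"
    and hall: "\<And>I. I \<subseteq> A \<Longrightarrow> sum r I \<le> sum s (R `` I)"
    and total: "sum r A = sum s B"
  obtains b :: "'a \<Rightarrow> 'b \<Rightarrow> nat" where "\<And>i j. b i j > 0 \<Longrightarrow> (i, j) \<in> R"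
    "\<And>i. i \<in> A \<Longrightarrow> (\<Sum>j\<in>B. b i j) = r i" "\<And>j. j \<in> B \<Longrightarrow> (\<Sum>i\<in>A. b i j) = s j"
proof -
  obtain b :: "'a \<Rightarrow> 'b \<Rightarrow> nat" where b: "\<forall>i j. b i j > 0 \<longrightarrow> (i, j) \<in> R"
    "\<forall>i\<in>A. (\<Sum>j\<in>B. b i j) = r i" "\<forall>j\<in>B. (\<Sum>i\<in>A. b i j) \<le> s j"
    using hall_supply_demand[OF fin hall] by blast
  have "(\<Sum>j\<in>B. \<Sum>i\<in>A. b i j) = (\<Sum>i\<in>A. \<Sum>j\<in>B. b i j)" by (rule sum.swap)
  also have "\<dots> = sum s B" using b(2) total by simp
  finally have "(\<Sum>i\<in>A. b i j) = s j" if "j \<in> B" for j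
    using sum_mono_inv[of "\<lambda>j. \<Sum>i\<in>A. b i j" B s] b(3) that fin by blast
  with b that show thesis by blast
qed

section \<open>From a positive coefficient to the existence of a factor\<close>

lemma weight_pos: "weight N k a > 0"
  unfolding weight_def by (intro prod_pos ballI divide_pos_pos prod_pos) auto

text \<open>Every summand is positive and the index set is finite, so positivity of the sum means
  that the index set is nonempty.\<close>

lemma exact_support_coeff_pos_iff:
  "exact_support_coeff N k F > 0 \<longleftrightarrow> (\<exists>a\<in>balanced_factors N k. supp N a = F)"
proof
  assume "exact_support_coeff N k F > 0"
  then have "{a \<in> balanced_factors N k. supp N a = F} \<noteq> {}"
    unfolding exact_support_coeff_def by force
  then show "\<exists>a\<in>balanced_factors N k. supp N a = F" by blast
next
  assume "\<exists>a\<in>balanced_factors N k. supp N a = F"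
  then show "exact_support_coeff N k F > 0"
    unfolding exact_support_coeff_def
    by (intro sum_pos weight_pos finite_subset[OF _ finite_balanced_factors[of N k]]) auto
qed

section \<open>Degrees as indicator sums over the index sets of the margins\<close>

lemma in_deg_eq_sum:
  assumes "F \<subseteq> edges N"
  shows "in_deg F i = (\<Sum>j\<in>{1..N} - {i}. of_bool ((j, i) \<in> F))"
proof -
  have *: "{j. (j, i) \<in> F} = ({1..N} - {i}) \<inter> {j. (j, i) \<in> F}"
    using assms by (auto simp: edges_def)
  show ?thesis unfolding in_deg_def by (subst *) simp
qed

lemma out_deg_eq_sum:
  assumes "F \<subseteq> edges N"
  shows "out_deg F j = (\<Sum>i\<in>{1..N} - {j}. of_bool ((j, i) \<in> F))"
proof -
  have *: "{i. (j, i) \<in> F} = ({1..N} - {j}) \<inter> {i. (j, i) \<in> F}"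
    using assms by (auto simp: edges_def)
  show ?thesis unfolding out_deg_def by (subst *) simp
qed

text \<open>Both sides count the edges of \<open>F\<close>. This makes the total residual demand and
  supply agree.\<close>

lemma sum_in_deg_eq_sum_out_deg:
  assumes "F \<subseteq> edges N"
  shows "(\<Sum>i\<in>{1..N}. in_deg F i) = (\<Sum>j\<in>{1..N}. out_deg F j)"
proof -
  have "in_deg F i = (\<Sum>j\<in>{1..N}. of_bool ((j, i) \<in> F))" for i
    unfolding in_deg_eq_sum[OF assms]
    by (rule sum.mono_neutral_left) (use assms in \<open>auto simp: edges_def\<close>)
  moreover have "out_deg F j = (\<Sum>i\<in>{1..N}. of_bool ((j, i) \<in> F))" for j
    unfolding out_deg_eq_sum[OF assms]
    by (rule sum.mono_neutral_left) (use assms in \<open>auto simp: edges_def\<close>)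
  ultimately show ?thesis
    by (simp only:) (rule sum.swap)
qed

section \<open>Factors with support \<open>F\<close> versus the residual conditions\<close>

lemma in_nbrs_eq_Image: "in_nbrs F I = F\<inverse> `` I"
  by (auto simp: in_nbrs_def)

text \<open>Removing one copy of each edge of \<open>F\<close> leaves a nonnegative array whose
  margins are the residuals; what enters \<open>I\<close> in it must come from in-neighbours of
  \<open>I\<close>.\<close>

lemma residual_conditions_of_balanced_factor:
  assumes a: "a \<in> balanced_factors N k" and F: "supp N a = F"
  shows "\<forall>i\<in>{1..N}. in_residual k F i \<ge> 0" (is ?in)
    and "\<forall>j\<in>{1..N}. out_residual k F j \<ge> 0" (is ?out)
    and "\<forall>I. I \<subseteq> {1..N} \<longrightarrow>
      (\<Sum>i\<in>I. in_residual k F i) \<le> (\<Sum>j\<in>in_nbrs F I. out_residual k F j)" (is ?hall)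
proof -
  \<comment> \<open>The surplus of \<open>a\<close> over the indicator of \<open>F\<close>. The
    value 0 off \<open>F\<close> covers the diagonal, where \<open>a\<close> is
    \<open>undefined\<close>, so margins may be summed over all of \<open>{1..N}\<close>.\<close>
  define c where "c j i = (if (j, i) \<in> F then int (a (j, i)) - 1 else 0)" for j i
  have sub: "F \<subseteq> edges N" using F by (auto simp: supp_def)
  have c: "int (a (j, i)) = c j i + of_bool ((j, i) \<in> F)" if "(j, i) \<in> edges N" for j i
    using F that by (auto simp: c_def supp_def)
  have c_nonneg: "c j i \<ge> 0" for j i using F by (auto simp: c_def supp_def)
  have c_diag: "c i i = 0" for i using sub by (auto simp: c_def edges_def)
  have r: "in_residual k F i = (\<Sum>j\<in>{1..N}. c j i)" if i: "i \<in> {1..N}" for i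
  proof -
    have "int (k i) = (\<Sum>j\<in>{1..N} - {i}. int (a (j, i)))"
      using a i by (auto simp: balanced_factors_def simp flip: of_nat_sum)
    also have "\<dots> = (\<Sum>j\<in>{1..N} - {i}. c j i + of_bool ((j, i) \<in> F))"
      using i by (intro sum.cong c) (auto simp: edges_def)
    finally show ?thesis
      using i sum.remove[of "{1..N}" i "\<lambda>j. c j i"]
      by (simp add: in_residual_def in_deg_eq_sum[OF sub] sum.distrib c_diag del: sum_of_bool_eq)
  qed
  have s: "out_residual k F j = (\<Sum>i\<in>{1..N}. c j i)" if j: "j \<in> {1..N}" for j
  proof -
    have "int (k j) = (\<Sum>i\<in>{1..N} - {j}. int (a (j, i)))"
      using a j by (auto simp: balanced_factors_def simp flip: of_nat_sum)
    also have "\<dots> = (\<Sum>i\<in>{1..N} - {j}. c j i + of_bool ((j, i) \<in> F))"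
      using j by (intro sum.cong c) (auto simp: edges_def)
    finally show ?thesis
      using j sum.remove[of "{1..N}" j "\<lambda>i. c j i"]
      by (simp add: out_residual_def out_deg_eq_sum[OF sub] sum.distrib c_diag del: sum_of_bool_eq)
  qed
  show ?in ?out using r s by (auto intro!: sum_nonneg c_nonneg)
  show ?hall
  proof (intro allI impI)
    fix I assume I: "I \<subseteq> {1..N}"
    have nb: "in_nbrs F I \<subseteq> {1..N}" using sub by (auto simp: in_nbrs_def edges_def)
    have "(\<Sum>i\<in>I. in_residual k F i) = (\<Sum>i\<in>I. \<Sum>j\<in>{1..N}. c j i)"
      using r I by (intro sum.cong) auto
    also have "\<dots> = (\<Sum>i\<in>I. \<Sum>j\<in>in_nbrs F I. c j i)"
      using nb by (intro sum.cong sum.mono_neutral_right) (auto simp: c_def in_nbrs_def)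
    also have "\<dots> = (\<Sum>j\<in>in_nbrs F I. \<Sum>i\<in>I. c j i)" by (rule sum.swap)
    \<comment> \<open>The neighbours of \<open>I\<close> may also send surplus to targets outside
      \<open>I\<close>.\<close>
    also have "\<dots> \<le> (\<Sum>j\<in>in_nbrs F I. \<Sum>i\<in>{1..N}. c j i)"
      using I by (intro sum_mono sum_mono2 c_nonneg) auto
    also have "\<dots> = (\<Sum>j\<in>in_nbrs F I. out_residual k F j)"
      using s nb by (intro sum.cong) auto
    finally show "(\<Sum>i\<in>I. in_residual k F i) \<le> (\<Sum>j\<in>in_nbrs F I. out_residual k F j)" .
  qed
qed

text \<open>The transport lemma fills the residual margins by an array supported in
  \<open>F\<close>; adding one copy of each edge of \<open>F\<close> restores the margins
  \<open>k\<close>.\<close>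

lemma balanced_factor_of_residual_conditions:
  assumes sub: "F \<subseteq> edges N"
    and r0: "\<forall>i\<in>{1..N}. in_residual k F i \<ge> 0"
    and s0: "\<forall>j\<in>{1..N}. out_residual k F j \<ge> 0"
    and hall: "\<forall>I. I \<subseteq> {1..N} \<longrightarrow>
      (\<Sum>i\<in>I. in_residual k F i) \<le> (\<Sum>j\<in>in_nbrs F I. out_residual k F j)"
  shows "\<exists>a\<in>balanced_factors N k. supp N a = F"
proof -
  define r where "r i = nat (in_residual k F i)" for i
  define s where "s j = nat (out_residual k F j)" for j
  have r: "int (r i) = in_residual k F i" if "i \<in> {1..N}" for i
    using r0 that by (simp add: r_def)
  have s: "int (s j) = out_residual k F j" if "j \<in> {1..N}" for j
    using s0 that by (simp add: s_def)
  \<comment> \<open>The converse is taken because targets carry the demand, so \<open>R\<close>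
    relates targets to sources.\<close>
  have rel: "F\<inverse> \<subseteq> {1..N} \<times> {1..N}" using sub by (auto simp: edges_def)
  have hall': "sum r I \<le> sum s (F\<inverse> `` I)" if I: "I \<subseteq> {1..N}" for I
  proof -
    have "int (sum r I) = (\<Sum>i\<in>I. in_residual k F i)"
      using I r by (auto intro!: sum.cong)
    also have "\<dots> \<le> (\<Sum>j\<in>in_nbrs F I. out_residual k F j)" using hall I by blast
    also have "\<dots> = int (sum s (in_nbrs F I))"
      using rel s by (auto simp: in_nbrs_eq_Image intro!: sum.cong)
    finally show ?thesis by (simp add: in_nbrs_eq_Image del: of_nat_sum)
  qed
  \<comment> \<open>Both totals equal the sum of \<open>k\<close> minus the number of edges of
    \<open>F\<close>.\<close>
  have "int (sum r {1..N}) = (\<Sum>i\<in>{1..N}. int (k i)) - int (\<Sum>i\<in>{1..N}. in_deg F i)"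
    using r by (simp add: in_residual_def sum_subtractf)
  also have "\<dots> = int (sum s {1..N})"
    unfolding sum_in_deg_eq_sum_out_deg[OF sub]
    using s by (simp add: out_residual_def sum_subtractf)
  finally have total: "sum r {1..N} = sum s {1..N}" by (simp only: of_nat_eq_iff)
  obtain b :: "nat \<Rightarrow> nat \<Rightarrow> nat" where b: "\<And>i j. b i j > 0 \<Longrightarrow> (i, j) \<in> F\<inverse>"
    "\<And>i. i \<in> {1..N} \<Longrightarrow> (\<Sum>j\<in>{1..N}. b i j) = r i"
    "\<And>j. j \<in> {1..N} \<Longrightarrow> (\<Sum>i\<in>{1..N}. b i j) = s j"
    using transport_exists[OF _ _ rel hall' total] by auto
  have b_diag: "b i i = 0" for i using b(1)[of i i] sub by (auto simp: edges_def)
  \<comment> \<open>The indices of \<open>b\<close> are swapped, target first. The added indicator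
    makes every edge of \<open>F\<close> positive, while \<open>b\<close> vanishes off
    \<open>F\<close>; restricting to \<open>edges N\<close> makes \<open>a\<close>
    extensional.\<close>
  define a where "a = (\<lambda>(j, i) \<in> edges N. b i j + of_bool ((j, i) \<in> F))"
  have a: "a (j, i) = b i j + of_bool ((j, i) \<in> F)" if "i \<in> {1..N}" "j \<in> {1..N}" "i \<noteq> j" for i j
    using that by (simp add: a_def edges_def)
  have "(\<Sum>j\<in>{1..N} - {i}. a (j, i)) = k i" if i: "i \<in> {1..N}" for i
  proof -
    have "(\<Sum>j\<in>{1..N} - {i}. a (j, i)) = (\<Sum>j\<in>{1..N} - {i}. b i j) + in_deg F i"
      unfolding in_deg_eq_sum[OF sub] sum.distrib[symmetric]
      by (rule sum.cong) (use i a in auto)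
    also have "(\<Sum>j\<in>{1..N} - {i}. b i j) = r i"
      using b(2)[OF i] i sum.remove[of "{1..N}" i "\<lambda>j. b i j"] by (simp add: b_diag)
    finally show ?thesis using r[OF i] by (simp add: in_residual_def)
  qed
  moreover have "(\<Sum>i\<in>{1..N} - {j}. a (j, i)) = k j" if j: "j \<in> {1..N}" for j
  proof -
    have "(\<Sum>i\<in>{1..N} - {j}. a (j, i)) = (\<Sum>i\<in>{1..N} - {j}. b i j) + out_deg F j"
      unfolding out_deg_eq_sum[OF sub] sum.distrib[symmetric]
      by (rule sum.cong) (use j a in auto)
    also have "(\<Sum>i\<in>{1..N} - {j}. b i j) = s j"
      using b(3)[OF j] j sum.remove[of "{1..N}" j "\<lambda>i. b i j"] by (simp add: b_diag)
    finally show ?thesis using s[OF j] by (simp add: out_residual_def)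
  qed
  ultimately have "a \<in> balanced_factors N k"
    by (auto simp: balanced_factors_def a_def)
  moreover have "supp N a = F"
    using sub b(1) by (auto simp: supp_def a_def split: if_splits)
  ultimately show ?thesis by blast
qed

theorem theorem6p1:
  fixes N :: nat and k :: "nat \<Rightarrow> nat" and F :: "(nat \<times> nat) set"
  assumes "N \<ge> 2"
    and "\<And>i. i \<in> {1..N} \<Longrightarrow> k i > 0"
    and "F \<subseteq> edges N"
  shows "exact_support_coeff N k F > 0 \<longleftrightarrow>
    (\<forall>i\<in>{1..N}. in_residual k F i \<ge> 0) \<and>
    (\<forall>j\<in>{1..N}. out_residual k F j \<ge> 0) \<and>
    (\<forall>I. I \<subseteq> {1..N} \<longrightarrow>
      (\<Sum>i\<in>I. in_residual k F i) \<le> (\<Sum>j\<in>in_nbrs F I. out_residual k F j))"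
  unfolding exact_support_coeff_pos_iff
  using residual_conditions_of_balanced_factor[of _ N k F]
    balanced_factor_of_residual_conditions[OF assms(3), of k]
  by blast

end
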